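(* Consider a family of multicommodity flow coalition games for which we have a core-producing algorithm (an algorithm which, given a game of the family, outputs an element of its core). Consider an instance $(G,c,H,d)$ of the family for which the fairness is at least $\tau$. For any $\lambda\in(0,1)$ we can compute a $\frac{1}{1-\lambda}$-approximate core vector $\pi$ of this instance with fairness at least $\lambda\tau$, i.e. $\min_{v\in V}\pi_v\ge\lambda\tau$.
   Context: **Multicommodity flow coalition game $(G,c,H,d)$.** $G=(V,E)$ is a finite undirected graph (supply graph) whose nodes are the players; each node has a capacity $c_v\ge 0$. $H=(V,F)$ is a simple undirected graph on the same node set (commodity graph); each commodity $uv\in F$ has a demand $d_{uv}\ge 0$. $\mathcal P_{uv}$ is the set of simple $u$–$v$ paths in $G$. A feasible flow assigns $f_P\ge 0$ to each $P\in\bigcup_{uv\in F}\mathcal P_{uv}$ with $\sum_{P\ni v} f_P\le c_v$ for all $v\in V$ (a path uses the capacity of all its nodes, including its endpoints) and $f_{uv}:=\sum_{P\in\mathcal P_{uv}}f_P\le d_{uv}$ for all $uv\in F$. For $S\subseteq V$, $\mathcal F^S$ is the set of feasible flows using only paths contained in $G[S]$ (for commodities with both ends in $S$). The payoff of $v$ under $f$ is $\pi_v(f)=\sum_{w:\,wv\in F} f_{wv}$, and $\Pi(S)=\{\pi(f): f\in\mathcal F^S\}$. **Core and approximate core.** For $\alpha\ge 1$, a vector $\pi\in\Pi(V)$ is an $\alpha$-approximate core vector (is in the $\alpha$-core) if there is no nonempty proper subset $S\subsetneq V$ and $\pi'\in\Pi(S)$ with $\pi'_v>\alpha\pi_v$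 for all $v\in S$. The core is the $1$-core. **Fairness.** The fairness of an instance is at least $\tau\ge 0$ if some $\pi\in\Pi(V)$ satisfies $\pi_v\ge\tau$ for all $v\in V$ (i.e. the corresponding linear program is feasible). The fairness of a payoff vector $\pi$ is $\min_{v\in V}\pi_v$. *)

theory Defs
  imports Complex_Main
begin

section \<open>Multicommodity flow coalition games\<close>

text \<open>Players are named by natural numbers, so that a game can be handed to an algorithm. An edge
  is the set of its two end nodes. Only the values of \<open>cap\<close> on \<open>nodes\<close> and of \<open>demand\<close> on
  \<open>commodities\<close> matter.\<close>

record game =
  nodes :: "nat set"
  edges :: "nat set set"
  cap :: "nat \<Rightarrow> real"
  commodities :: "nat set set"
  demand :: "nat set \<Rightarrow> real"

text \<open>The supply graph may have loops (which no simple path uses); the commodity graph is simple.\<close>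

definition mcf_game :: "game \<Rightarrow> bool" where
  "mcf_game G \<longleftrightarrow>
     finite (nodes G) \<and> nodes G \<noteq> {} \<and>
     edges G \<subseteq> {{u, v} | u v. u \<in> nodes G \<and> v \<in> nodes G} \<and>
     commodities G \<subseteq> {{u, v} | u v. u \<in> nodes G \<and> v \<in> nodes G \<and> u \<noteq> v} \<and>
     (\<forall>v\<in>nodes G. 0 \<le> cap G v) \<and>
     (\<forall>e\<in>commodities G. 0 \<le> demand G e)"

text \<open>A simple path is given by its node sequence.\<close>

definition simple_path :: "game \<Rightarrow> nat list \<Rightarrow> bool" where
  "simple_path G P \<longleftrightarrow>
     P \<noteq> [] \<and> distinct P \<and> set P \<subseteq> nodes G \<and> successively (\<lambda>u v. {u, v} \<in> edges G) P"

text \<open>A node sequence and its reversal are the same undirected path; the condition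
  \<open>hd P < last P\<close> selects one of the two.\<close>

definition paths :: "game \<Rightarrow> nat set \<Rightarrow> nat list set" where
  "paths G e = {P. simple_path G P \<and> hd P < last P \<and> {hd P, last P} = e}"

definition all_paths :: "game \<Rightarrow> nat list set" where
  "all_paths G = (\<Union>e\<in>commodities G. paths G e)"

definition commodity_flow :: "game \<Rightarrow> (nat list \<Rightarrow> real) \<Rightarrow> nat set \<Rightarrow> real" where
  "commodity_flow G f e = (\<Sum>P\<in>paths G e. f P)"

definition feasible_flow :: "game \<Rightarrow> (nat list \<Rightarrow> real) \<Rightarrow> bool" where
  "feasible_flow G f \<longleftrightarrow>
     (\<forall>P\<in>all_paths G. 0 \<le> f P) \<and>
     (\<forall>v\<in>nodes G. (\<Sum>P\<in>{P \<in> all_paths G. v \<in> set P}. f P) \<le> cap G v) \<and>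
     (\<forall>e\<in>commodities G. commodity_flow G f e \<le> demand G e)"

definition coalition_flows :: "game \<Rightarrow> nat set \<Rightarrow> (nat list \<Rightarrow> real) set" where
  "coalition_flows G S =
     {f. feasible_flow G f \<and> (\<forall>P\<in>all_paths G. \<not> set P \<subseteq> S \<longrightarrow> f P = 0)}"

definition payoff :: "game \<Rightarrow> (nat list \<Rightarrow> real) \<Rightarrow> nat \<Rightarrow> real" where
  "payoff G f v = (\<Sum>w\<in>{w. {w, v} \<in> commodities G}. commodity_flow G f {w, v})"

definition payoffs :: "game \<Rightarrow> nat set \<Rightarrow> (nat \<Rightarrow> real) set" where
  "payoffs G S = payoff G ` coalition_flows G S"

definition approx_core :: "game \<Rightarrow> real \<Rightarrow> (nat \<Rightarrow> real) set" where
  "approx_core G \<alpha> =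
     {\<pi> \<in> payoffs G (nodes G).
        \<not> (\<exists>S \<pi>'. S \<noteq> {} \<and> S \<subset> nodes G \<and> \<pi>' \<in> payoffs G S \<and> (\<forall>v\<in>S. \<pi>' v > \<alpha> * \<pi> v))}"

abbreviation core :: "game \<Rightarrow> (nat \<Rightarrow> real) set" where
  "core G \<equiv> approx_core G 1"

definition fairness_at_least :: "game \<Rightarrow> real \<Rightarrow> bool" where
  "fairness_at_least G \<tau> \<longleftrightarrow> (\<exists>\<pi>\<in>payoffs G (nodes G). \<forall>v\<in>nodes G. \<tau> \<le> \<pi> v)"

definition fairness :: "game \<Rightarrow> (nat \<Rightarrow> real) \<Rightarrow> real" where
  "fairness G \<pi> = Min (\<pi> ` nodes G)"


section \<open>Algorithms\<close>

text \<open>Capacities, demands and the parameters of the algorithms are real numbers, so an algorithm is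
  a program over the real numbers (a real RAM, or Blum-Shub-Smale machine) with exact field
  operations and sign tests, working on binary trees with real leaves. The only built-in constant
  is 1; hence on trees with rational leaves every intermediate leaf is rational, and programs
  are then ordinary Turing machine algorithms.\<close>

datatype data = Atom real | Node data data

datatype prog =
    PId | POne | PAdd | PSub | PMul | PDiv
  | PLeft | PRight | PIsAtom
  | PNode prog prog
  | PSeq prog prog
  | PIf prog prog prog
  | PWhile prog prog

text \<open>\<open>runs p x y\<close>: program \<open>p\<close> halts on input \<open>x\<close> with output \<open>y\<close>. A test succeeds if it yields a
  positive number. Ill-typed operations and division by zero have no result.\<close>

inductive runs :: "prog \<Rightarrow> data \<Rightarrow> data \<Rightarrow> bool" where
  Id: "runs PId x x"
| One: "runs POne x (Atom 1)"
| Add: "runs PAdd (Node (Atom a) (Atom b)) (Atom (a + b))"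
| Sub: "runs PSub (Node (Atom a) (Atom b)) (Atom (a - b))"
| Mul: "runs PMul (Node (Atom a) (Atom b)) (Atom (a * b))"
| Div: "b \<noteq> 0 \<Longrightarrow> runs PDiv (Node (Atom a) (Atom b)) (Atom (a / b))"
| Left: "runs PLeft (Node x y) x"
| Right: "runs PRight (Node x y) y"
| IsAtom_Atom: "runs PIsAtom (Atom a) (Atom 1)"
| IsAtom_Node: "runs PIsAtom (Node x y) (Atom 0)"
| Node: "runs p x y \<Longrightarrow> runs q x z \<Longrightarrow> runs (PNode p q) x (Node y z)"
| Seq: "runs p x y \<Longrightarrow> runs q y z \<Longrightarrow> runs (PSeq p q) x z"
| If_pos: "runs t x (Atom a) \<Longrightarrow> 0 < a \<Longrightarrow> runs p x y \<Longrightarrow> runs (PIf t p q) x y"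
| If_nonpos: "runs t x (Atom a) \<Longrightarrow> a \<le> 0 \<Longrightarrow> runs q x y \<Longrightarrow> runs (PIf t p q) x y"
| While_pos: "runs t x (Atom a) \<Longrightarrow> 0 < a \<Longrightarrow> runs p x y \<Longrightarrow> runs (PWhile t p) y z
    \<Longrightarrow> runs (PWhile t p) x z"
| While_nonpos: "runs t x (Atom a) \<Longrightarrow> a \<le> 0 \<Longrightarrow> runs (PWhile t p) x x"

lemma runs_PNodeE: "runs (PNode p q) x w \<Longrightarrow> \<exists>y z. w = Node y z \<and> runs p x y \<and> runs q x z"
  by (erule runs.cases) simp_all

lemma runs_PSeqE: "runs (PSeq p q) x z \<Longrightarrow> \<exists>y. runs p x y \<and> runs q y z"
  by (erule runs.cases) (simp_all, blast)

lemma runs_PIfE: "runs (PIf t p q) x y \<Longrightarrow>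
    \<exists>a. runs t x (Atom a) \<and> (if 0 < a then runs p x y else runs q x y)"
  by (erule runs.cases) (simp_all, (metis not_le)+)

lemma runs_PWhileE: "runs (PWhile t p) x z \<Longrightarrow>
    \<exists>a. runs t x (Atom a) \<and> (if 0 < a then \<exists>y. runs p x y \<and> runs (PWhile t p) y z else z = x)"
  by (erule runs.cases) (simp_all, (metis not_le)+)

lemma runs_deterministic: "runs p x y \<Longrightarrow> runs p x z \<Longrightarrow> y = z"
proof (induction arbitrary: z rule: runs.induct)
  case (Node p x y q w)
  then show ?case by (metis runs_PNodeE)
next
  case (Seq p x y q w)
  then show ?case by (metis runs_PSeqE)
next
  case (If_pos t x a p y q)
  then show ?case by (metis runs_PIfE data.inject(1))
next
  case (If_nonpos t x a q y p)
  then show ?case by (metis runs_PIfE data.inject(1) not_le)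
next
  case (While_pos t x a p y w)
  then show ?case by (metis runs_PWhileE data.inject(1))
next
  case (While_nonpos t x a p)
  then show ?case by (metis runs_PWhileE data.inject(1) not_le)
qed (erule runs.cases; simp)+

primrec enc_list :: "data list \<Rightarrow> data" where
  "enc_list [] = Atom 0"
| "enc_list (x # xs) = Node x (enc_list xs)"

text \<open>A node set is listed in increasing order; a set of edges is the list of its pairs \<open>u \<le> v\<close>.\<close>

definition node_list :: "game \<Rightarrow> nat list" where
  "node_list G = sorted_list_of_set (nodes G)"

definition edge_list :: "game \<Rightarrow> nat set set \<Rightarrow> (nat \<times> nat) list" where
  "edge_list G X =
     filter (\<lambda>(u, v). u \<le> v \<and> {u, v} \<in> X) (List.product (node_list G) (node_list G))"

definition enc_edge :: "nat \<times> nat \<Rightarrow> data" where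
  "enc_edge = (\<lambda>(u, v). Node (Atom (real u)) (Atom (real v)))"

definition enc_game :: "game \<Rightarrow> data" where
  "enc_game G =
     Node (enc_list (map (\<lambda>v. Node (Atom (real v)) (Atom (cap G v))) (node_list G)))
      (Node (enc_list (map enc_edge (edge_list G (edges G))))
        (enc_list (map (\<lambda>(u, v). Node (enc_edge (u, v)) (Atom (demand G {u, v})))
          (edge_list G (commodities G)))))"

text \<open>Payoff vectors are 0 outside \<open>nodes G\<close>, so listing the values on \<open>nodes G\<close> determines them.\<close>

definition enc_payoff :: "game \<Rightarrow> (nat \<Rightarrow> real) \<Rightarrow> data" where
  "enc_payoff G \<pi> = enc_list (map (\<lambda>v. Atom (\<pi> v)) (node_list G))"

definition core_producing :: "prog \<Rightarrow> game set \<Rightarrow> bool" where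
  "core_producing A \<G> \<longleftrightarrow> (\<forall>G\<in>\<G>. \<exists>\<pi>\<in>core G. runs A (enc_game G) (enc_payoff G \<pi>))"

end

theory Submission
  imports Defs
begin

text \<open>If \<open>f\<close> is a flow whose payoff vector is in the core and \<open>g\<close> is a flow giving every player at
  least \<open>\<tau>\<close>, then \<open>(1 - lam) f + lam g\<close> is feasible by convexity, gives every player at least
  \<open>lam \<tau>\<close>, and at least the fraction \<open>1 - lam\<close> of the core payoff; so a coalition improving on it by
  more than the factor \<open>1 / (1 - lam)\<close> would block the core vector. The flow \<open>g\<close> solves a system
  of linear inequalities with one variable per path; it is found exactly, in real arithmetic, by
  Fourier--Motzkin elimination. Programs for this are not written out: the functions with a program
  are closed under pairing, case distinction and \<open>foldl\<close>, and the solver is composed from these.\<close>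

section \<open>Functions computable by real programs\<close>

text \<open>No law is imposed on \<open>enc\<close>, and codes of different types may coincide:
  \<open>0\<close>, \<open>False\<close> and \<open>[]\<close> all become \<open>Atom 0\<close>. A
  program is only specified on codes of its input type.\<close>

class codable =
  fixes enc :: "'a \<Rightarrow> data"

instantiation real :: codable
begin
definition enc_real :: "real \<Rightarrow> data" where [simp]: "enc_real = Atom"
instance ..
end

instantiation nat :: codable
begin
definition enc_nat :: "nat \<Rightarrow> data" where [simp]: "enc_nat n = Atom (real n)"
instance ..
end

instantiation bool :: codable
begin
definition enc_bool :: "bool \<Rightarrow> data" where [simp]: "enc_bool b = Atom (of_bool b)"
instance ..
end

instantiation prod :: (codable, codable) codable
begin
definition enc_prod :: "'a \<times> 'b \<Rightarrow> data" where
  [simp]: "enc_prod z = Node (enc (fst z)) (enc (snd z))"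
instance ..
end

instantiation list :: (codable) codable
begin
definition enc_list :: "'a list \<Rightarrow> data" where [simp]: "enc_list xs = Defs.enc_list (map enc xs)"
instance ..
end

definition computable :: "('a::codable \<Rightarrow> 'b::codable) \<Rightarrow> bool" where
  "computable f \<longleftrightarrow> (\<exists>p. \<forall>x. runs p (enc x) (enc (f x)))"

lemma computable_cong: "computable f \<Longrightarrow> (\<And>x. f x = g x) \<Longrightarrow> computable g"
  by (simp add: computable_def)

named_theorems computable_intros

lemma computable_id [computable_intros]: "computable (\<lambda>x. x)"
  unfolding computable_def by (blast intro: runs.intros)

lemma computable_compose:
  assumes "computable f" and "computable g"
  shows "computable (\<lambda>x. g (f x))"
  using assms unfolding computable_def by (metis runs.Seq)

lemma computable_Pair [computable_intros]:
  assumes "computable f" and "computable g"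
  shows "computable (\<lambda>x. (f x, g x))"
proof -
  obtain p q where "\<And>x. runs p (enc x) (enc (f x))" "\<And>x. runs q (enc x) (enc (g x))"
    using assms unfolding computable_def by blast
  then have "\<forall>x. runs (PNode p q) (enc x) (enc (f x, g x))"
    by (simp add: runs.Node)
  then show ?thesis
    unfolding computable_def by blast
qed

lemma computable_fst [computable_intros]: "computable f \<Longrightarrow> computable (\<lambda>x. fst (f x))"
  unfolding computable_def by (metis enc_prod_def runs.Left runs.Seq)

lemma computable_snd [computable_intros]: "computable f \<Longrightarrow> computable (\<lambda>x. snd (f x))"
  unfolding computable_def by (metis enc_prod_def runs.Right runs.Seq)

lemma computable_binary:
  assumes "\<And>a b. runs p (Node (enc a) (enc b)) (enc (op a b))"
    and "computable f" and "computable g"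
  shows "computable (\<lambda>x. op (f x) (g x))"
proof -
  have "computable (\<lambda>z. op (fst z) (snd z))"
    using assms(1) unfolding computable_def enc_prod_def by blast
  from computable_compose[OF computable_Pair[OF assms(2,3)] this] show ?thesis
    by simp
qed

lemma computable_If [computable_intros]:
  assumes "computable b" and "computable f" and "computable g"
  shows "computable (\<lambda>x. if b x then f x else g x)"
proof -
  obtain t p q where run: "\<And>x. runs t (enc x) (enc (b x))"
    "\<And>x. runs p (enc x) (enc (f x))" "\<And>x. runs q (enc x) (enc (g x))"
    using assms unfolding computable_def by blast
  have "runs (PIf t p q) (enc x) (enc (if b x then f x else g x))" for x
    using run[of x] by (cases "b x") (auto intro: runs.If_pos runs.If_nonpos)
  then show ?thesis
    unfolding computable_def by blast
qed

section \<open>Constants, arithmetic and comparisons\<close>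

text \<open>The only built-in constant is 1, so 0 is produced as 1 - 1.\<close>

lemma runs_zero: "runs (PSeq (PNode POne POne) PSub) x (Atom 0)"
  using runs.Seq[OF runs.Node[OF runs.One runs.One] runs.Sub[of 1 1]] by simp

lemma computable_zero_one [computable_intros]:
  "computable (\<lambda>x. 0::real)" "computable (\<lambda>x. 1::real)" "computable (\<lambda>x. 0::nat)"
  "computable (\<lambda>x. True)" "computable (\<lambda>x. False)"
  unfolding computable_def using runs_zero runs.One by fastforce+

lemma computable_Nil [computable_intros]: "computable (\<lambda>x. [])"
  unfolding computable_def using runs_zero by fastforce

lemma computable_arith [computable_intros]:
  fixes f g :: "'a::codable \<Rightarrow> real"
  assumes "computable f" and "computable g"
  shows "computable (\<lambda>x. f x + g x)" and "computable (\<lambda>x. f x - g x)"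
    and "computable (\<lambda>x. f x * g x)"
  by (rule computable_binary[OF _ assms]; simp; rule runs.intros)+

lemma computable_uminus [computable_intros]:
  fixes f :: "'a::codable \<Rightarrow> real"
  assumes "computable f"
  shows "computable (\<lambda>x. - f x)"
  using computable_arith(2)[OF computable_zero_one(1) assms] by simp

lemma runs_test_pos: "runs (PIf PId POne (PSeq (PNode POne POne) PSub)) (Atom a) (enc (0 < a))"
  using runs.If_pos[OF runs.Id _ runs.One] runs.If_nonpos[OF runs.Id _ runs_zero]
  by (cases "0 < a") auto

lemma computable_real_less [computable_intros]:
  fixes f g :: "'a::codable \<Rightarrow> real"
  assumes "computable f" and "computable g"
  shows "computable (\<lambda>x. f x < g x)"
proof -
  have "computable (\<lambda>a::real. 0 < a)"
    unfolding computable_def using runs_test_pos by (metis enc_real_def)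
  from computable_compose[OF computable_arith(2)[OF assms(2,1)] this] show ?thesis
    by simp
qed

text \<open>A natural number and its real value have the same code, so the program for
  \<open>f\<close> serves unchanged.\<close>

lemma computable_real [computable_intros]:
  fixes f :: "'a::codable \<Rightarrow> nat"
  assumes "computable f"
  shows "computable (\<lambda>x. real (f x))"
  using assms unfolding computable_def by simp

lemma computable_Not [computable_intros]: "computable b \<Longrightarrow> computable (\<lambda>x. \<not> b x)"
  by (rule computable_cong[OF computable_If[OF _ computable_zero_one(5,4)]]) auto

lemma computable_conj [computable_intros]:
  "computable b \<Longrightarrow> computable c \<Longrightarrow> computable (\<lambda>x. b x \<and> c x)"
  by (rule computable_cong[OF computable_If[OF _ _ computable_zero_one(5), of b c]]) auto

lemma computable_disj [computable_intros]:
  "computable b \<Longrightarrow> computable c \<Longrightarrow> computable (\<lambda>x. b x \<or> c x)"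
  by (rule computable_cong[OF computable_If[OF _ computable_zero_one(4), of b c]]) auto

lemma computable_nat_less [computable_intros]:
  fixes f g :: "'a::codable \<Rightarrow> nat"
  assumes "computable f" and "computable g"
  shows "computable (\<lambda>x. f x < g x)"
  using computable_real_less[OF computable_real[OF assms(1)] computable_real[OF assms(2)]] by simp

lemma computable_nat_eq [computable_intros]:
  fixes f g :: "'a::codable \<Rightarrow> nat"
  assumes "computable f" and "computable g"
  shows "computable (\<lambda>x. f x = g x)"
proof -
  have "computable (\<lambda>x. \<not> f x < g x \<and> \<not> g x < f x)"
    by (intro computable_intros assms)
  then show ?thesis
    by (rule computable_cong) auto
qed

lemma computable_max [computable_intros]:
  fixes f g :: "'a::codable \<Rightarrow> real"
  assumes "computable f" and "computable g"
  shows "computable (\<lambda>x. max (f x) (g x))"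
proof -
  have "computable (\<lambda>x. if f x < g x then g x else f x)"
    by (intro computable_intros assms)
  then show ?thesis
    by (rule computable_cong) (simp add: max_def)
qed

text \<open>\<open>PDiv\<close> has no result for divisor zero, whereas \<open>a / 0 = 0\<close> in
  HOL. A sign test sends that case to the constant 0.\<close>

lemma computable_divide [computable_intros]:
  fixes f g :: "'a::codable \<Rightarrow> real"
  assumes "computable f" and "computable g"
  shows "computable (\<lambda>x. f x / g x)"
proof -
  have "computable (\<lambda>z :: real \<times> real. 0 < snd z \<or> snd z < 0)"
    by (intro computable_intros)
  then obtain t where t: "runs t (enc z) (enc (0 < snd z \<or> snd z < 0))" for z :: "real \<times> real"
    unfolding computable_def by blast
  show ?thesis
  proof (rule computable_binary[OF _ assms])
    fix a b :: real
    show "runs (PIf t PDiv (PSeq (PNode POne POne) PSub)) (Node (enc a) (enc b)) (enc (a / b))"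
      using t[of "(a, b)"] runs_zero
      by (cases "b = 0") (auto intro: runs.If_pos runs.If_nonpos runs.Div)
  qed
qed

section \<open>Lists and loops\<close>

text \<open>The code of \<open>x # xs\<close> is the code of the pair \<open>(x, xs)\<close>, so the
  identity program does it.\<close>

lemma computable_Cons [computable_intros]:
  assumes "computable f" and "computable g"
  shows "computable (\<lambda>x. f x # g x)"
  by (rule computable_binary[OF _ assms]) (simp, rule runs.Id)

text \<open>The root of a list code shows emptiness: it is an atom for \<open>[]\<close> and a node
  otherwise.\<close>

lemma computable_case_list [computable_intros]:
  assumes "computable l" and "computable g"
    and "computable (\<lambda>z. h (fst z) (fst (snd z)) (snd (snd z)))"
  shows "computable (\<lambda>x. case l x of [] \<Rightarrow> g x | y # ys \<Rightarrow> h x y ys)"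
proof -
  obtain p q r where run: "\<And>x. runs p (enc x) (enc (l x))" "\<And>x. runs q (enc x) (enc (g x))"
    "\<And>x y ys. runs r (Node (enc x) (Node (enc y) (enc ys))) (enc (h x y ys))"
    using assms unfolding computable_def enc_prod_def by (metis fst_conv snd_conv)
  have "runs (PIf (PSeq p PIsAtom) q (PSeq (PNode PId p) r)) (enc x)
      (enc (case l x of [] \<Rightarrow> g x | y # ys \<Rightarrow> h x y ys))" for x
  proof (cases "l x")
    case Nil
    then have "runs (PSeq p PIsAtom) (enc x) (Atom 1)"
      using run(1)[of x] runs.Seq runs.IsAtom_Atom by fastforce
    then show ?thesis
      using runs.If_pos run(2) Nil by simp
  next
    case (Cons y ys)
    then have l: "runs p (enc x) (Node (enc y) (enc ys))"
      using run(1)[of x] by simp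
    then have "runs (PSeq p PIsAtom) (enc x) (Atom 0)"
      using runs.Seq runs.IsAtom_Node by blast
    moreover have "runs (PSeq (PNode PId p) r) (enc x) (enc (h x y ys))"
      by (rule runs.Seq[OF runs.Node[OF runs.Id l] run(3)])
    ultimately show ?thesis
      using runs.If_nonpos Cons by simp
  qed
  then show ?thesis
    unfolding computable_def by blast
qed

text \<open>A while loop runs on the state \<open>Node x (Node a ys)\<close>: the fixed input, on
  which \<open>h\<close> may depend, the accumulator and the remaining list.\<close>

lemma computable_foldl [computable_intros]:
  assumes "computable s" and "computable l"
    and "computable (\<lambda>z. h (fst z) (fst (snd z)) (snd (snd z)))"
  shows "computable (\<lambda>x. foldl (h x) (s x) (l x))"
proof -
  obtain p q r where run: "\<And>x. runs p (enc x) (enc (s x))" "\<And>x. runs q (enc x) (enc (l x))"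
    "\<And>x a y. runs r (Node (enc x) (Node (enc a) (enc y))) (enc (h x a y))"
    using assms unfolding computable_def enc_prod_def by (metis fst_conv snd_conv)
  define list where "list = PSeq PRight PRight"
  \<comment> \<open>\<open>PIsAtom\<close> succeeds on the empty list, which is when the loop must
    stop, so its answer is inverted.\<close>
  define test where "test = PIf (PSeq list PIsAtom) (PSeq (PNode POne POne) PSub) POne"
  define body where "body = PNode PLeft (PNode
    (PSeq (PNode PLeft (PNode (PSeq PRight PLeft) (PSeq list PLeft))) r) (PSeq list PRight))"
  have list: "runs list (Node a (Node b c)) c" for a b c
    unfolding list_def by (blast intro: runs.intros)
  have loop: "runs (PWhile test body) (Node (enc x) (Node (enc a) (enc ys)))
      (Node (enc x) (Node (enc (foldl (h x) a ys)) (Atom 0)))" for x a ys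
  proof (induction ys arbitrary: a)
    case Nil
    have "runs test (Node (enc x) (Node (enc a) (Atom 0))) (Atom 0)"
      unfolding test_def
      by (rule runs.If_pos[OF runs.Seq[OF list runs.IsAtom_Atom] _ runs_zero]) simp
    then show ?case
      using runs.While_nonpos by simp
  next
    case (Cons y ys)
    have "runs test (Node (enc x) (Node (enc a) (Node (enc y) (enc ys)))) (Atom 1)"
      unfolding test_def
      by (rule runs.If_nonpos[OF runs.Seq[OF list runs.IsAtom_Node] _ runs.One]) simp
    moreover have "runs body (Node (enc x) (Node (enc a) (Node (enc y) (enc ys))))
        (Node (enc x) (Node (enc (h x a y)) (enc ys)))"
      unfolding body_def by (intro runs.Node runs.Left runs.Seq[OF list] runs.Right
          runs.Seq[OF runs.Right] runs.Seq[OF _ run(3)])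
    ultimately show ?case
      using runs.While_pos[OF _ _ _ Cons.IH] by simp
  qed
  have "runs (PSeq (PSeq (PNode PId (PNode p q)) (PWhile test body)) (PSeq PRight PLeft)) (enc x)
      (enc (foldl (h x) (s x) (l x)))" for x
    by (rule runs.Seq[OF runs.Seq[OF runs.Node[OF runs.Id runs.Node[OF run(1,2)]] loop]
          runs.Seq[OF runs.Right runs.Left]])
  then show ?thesis
    unfolding computable_def by blast
qed

text \<open>Turns the computability of \<open>h\<close> on pairs into an introduction rule for
  \<open>h\<close> applied to arbitrary computable arguments.\<close>

lemma computable_lift2:
  assumes "computable (\<lambda>z. h (fst z) (snd z))" and "computable f" and "computable g"
  shows "computable (\<lambda>x. h (f x) (g x))"
  using computable_compose[OF computable_Pair[OF assms(2,3)] assms(1)] by simp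

lemma computable_lift3:
  assumes "computable (\<lambda>z. h (fst z) (fst (snd z)) (snd (snd z)))"
    and "computable f" and "computable g" and "computable k"
  shows "computable (\<lambda>x. h (f x) (g x) (k x))"
  using computable_compose[OF computable_Pair[OF assms(2) computable_Pair[OF assms(3,4)]] assms(1)]
  by simp

section \<open>List functions derived from case distinction and \<open>foldl\<close>\<close>

lemma computable_tl [computable_intros]:
  fixes l :: "'a::codable \<Rightarrow> 'b::codable list"
  shows "computable l \<Longrightarrow> computable (\<lambda>x. tl (l x))"
proof (rule computable_compose[where g = tl])
  have "computable (\<lambda>l :: 'b list. case l of [] \<Rightarrow> [] | y # ys \<Rightarrow> ys)"
    by (intro computable_intros)
  then show "computable (tl :: 'b list \<Rightarrow> _)"
    by (rule computable_cong) (simp split: list.split)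
qed

lemma computable_rev [computable_intros]:
  fixes l :: "'a::codable \<Rightarrow> 'b::codable list"
  shows "computable l \<Longrightarrow> computable (\<lambda>x. rev (l x))"
proof (rule computable_compose[where g = rev])
  have "computable (\<lambda>l :: 'b list. foldl (\<lambda>s x. x # s) [] l)"
    by (intro computable_intros)
  then show "computable (rev :: 'b list \<Rightarrow> _)"
    by (rule computable_cong) (simp add: foldl_conv_fold fold_Cons_rev)
qed

lemma computable_append [computable_intros]:
  fixes l m :: "'a::codable \<Rightarrow> 'b::codable list"
  shows "computable l \<Longrightarrow> computable m \<Longrightarrow> computable (\<lambda>x. l x @ m x)"
proof (rule computable_lift2[where h = "(@)"])
  have "computable (\<lambda>z :: 'b list \<times> 'b list. foldl (\<lambda>s x. x # s) (snd z) (rev (fst z)))"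
    by (intro computable_intros)
  then show "computable (\<lambda>z :: 'b list \<times> 'b list. fst z @ snd z)"
    by (rule computable_cong) (simp add: foldl_conv_fold fold_Cons_rev)
qed

lemma computable_map [computable_intros]:
  assumes "computable l" and "computable (\<lambda>z. h (fst z) (snd z))"
  shows "computable (\<lambda>x. map (h x) (l x))"
proof -
  have "foldl (\<lambda>s y. h x y # s) s ys = rev (map (h x) ys) @ s" for x s ys
    by (induction ys arbitrary: s) auto
  moreover have "computable (\<lambda>x. rev (foldl (\<lambda>s y. h x y # s) [] (l x)))"
    by (intro computable_intros assms(1) computable_lift2[OF assms(2)])
  ultimately show ?thesis
    by simp
qed

lemma computable_filter [computable_intros]:
  assumes "computable l" and "computable (\<lambda>z. h (fst z) (snd z))"
  shows "computable (\<lambda>x. filter (h x) (l x))"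
proof -
  have "foldl (\<lambda>s y. if h x y then y # s else s) s ys = rev (filter (h x) ys) @ s" for x s ys
    by (induction ys arbitrary: s) auto
  moreover have "computable (\<lambda>x. rev (foldl (\<lambda>s y. if h x y then y # s else s) [] (l x)))"
    by (intro computable_intros assms(1) computable_lift2[OF assms(2)])
  ultimately show ?thesis
    by simp
qed

lemma computable_Bex [computable_intros]:
  assumes "computable l" and "computable (\<lambda>z. h (fst z) (snd z))"
  shows "computable (\<lambda>x. \<exists>y\<in>set (l x). h x y)"
proof -
  have "foldl (\<lambda>s y. s \<or> h x y) s ys \<longleftrightarrow> s \<or> (\<exists>y\<in>set ys. h x y)" for x s ys
    by (induction ys arbitrary: s) auto
  moreover have "computable (\<lambda>x. foldl (\<lambda>s y. s \<or> h x y) False (l x))"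
    by (intro computable_intros assms(1) computable_lift2[OF assms(2)])
  ultimately show ?thesis
    by simp
qed

lemma computable_concat [computable_intros]:
  fixes l :: "'a::codable \<Rightarrow> 'b::codable list list"
  shows "computable l \<Longrightarrow> computable (\<lambda>x. concat (l x))"
proof (rule computable_compose[where g = concat])
  have "computable (\<lambda>l :: 'b list list. foldl (\<lambda>s x. s @ x) [] l)"
    by (intro computable_intros)
  moreover have "foldl (\<lambda>s x. s @ x) s l = s @ concat l" for s and l :: "'b list list"
    by (induction l arbitrary: s) auto
  ultimately show "computable (concat :: 'b list list \<Rightarrow> _)"
    by simp
qed

lemma computable_sum_list [computable_intros]:
  fixes l :: "'a::codable \<Rightarrow> real list"
  shows "computable l \<Longrightarrow> computable (\<lambda>x. sum_list (l x))"
proof (rule computable_compose[where g = sum_list])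
  have "foldl (\<lambda>s x. s + x) s xs = s + sum_list xs" for s and xs :: "real list"
    by (induction xs arbitrary: s) auto
  moreover have "computable (\<lambda>l :: real list. foldl (\<lambda>s x. s + x) 0 l)"
    by (intro computable_intros)
  ultimately show "computable (sum_list :: real list \<Rightarrow> _)"
    by simp
qed

lemma computable_zip [computable_intros]:
  fixes l :: "'a::codable \<Rightarrow> 'b::codable list" and m :: "'a \<Rightarrow> 'c::codable list"
  shows "computable l \<Longrightarrow> computable m \<Longrightarrow> computable (\<lambda>x. zip (l x) (m x))"
proof (rule computable_lift2[where h = zip])
  \<comment> \<open>The fold runs over the first list and carries the unread part of the second;
    once that is exhausted, nothing more is collected.\<close>
  let ?step = "\<lambda>(s :: ('b \<times> 'c) list \<times> 'c list) x.
    case snd s of [] \<Rightarrow> (fst s, []) | y # ys \<Rightarrow> ((x, y) # fst s, ys)"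
  have "fst (foldl ?step (s, ys) xs) = rev (zip xs ys) @ s" for s xs ys
    by (induction xs arbitrary: s ys) (auto split: list.split)
  moreover have "computable (\<lambda>z. rev (fst (foldl ?step ([], snd z) (fst z))))"
    by (intro computable_intros)
  ultimately show "computable (\<lambda>z :: 'b list \<times> 'c list. zip (fst z) (snd z))"
    by simp
qed


section \<open>Fourier--Motzkin elimination over the nonnegative orthant\<close>

definition dot :: "real list \<Rightarrow> real list \<Rightarrow> real" where
  "dot a x = sum_list (map (\<lambda>p. fst p * snd p) (zip a x))"

definition lead :: "real list \<Rightarrow> real" where
  "lead a = (case a of [] \<Rightarrow> 0 | c # cs \<Rightarrow> c)"

text \<open>A pair \<open>(a, b)\<close> stands for the inequality \<open>dot a x \<le> b\<close>; the inequalities \<open>0 \<le> x\<^sub>i\<close> are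
  implicit.\<close>

type_synonym row = "real list \<times> real"

text \<open>For \<open>lead (fst r) > 0 > lead (fst s)\<close>, dividing by the leads turns
  \<open>r\<close> into an upper and \<open>s\<close> into a lower bound on the first variable. The
  new row says that the lower bound is at most the upper one.\<close>

definition combine :: "row \<Rightarrow> row \<Rightarrow> row" where
  "combine r s =
     (map (\<lambda>p. fst p / lead (fst r) - snd p / lead (fst s)) (zip (tl (fst r)) (tl (fst s))),
      snd r / lead (fst r) - snd s / lead (fst s))"

text \<open>Rows with a positive leading coefficient are kept, too: combined with the implicit
  inequality \<open>0 \<le> x\<^sub>0\<close> they lose their leading term.\<close>

definition eliminate :: "row list \<Rightarrow> row list" where
  "eliminate S =
     map (\<lambda>r. (tl (fst r), snd r)) (filter (\<lambda>r. \<not> lead (fst r) < 0) S) @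
     concat (map (\<lambda>r. map (combine r) (filter (\<lambda>s. lead (fst s) < 0) S))
       (filter (\<lambda>r. 0 < lead (fst r)) S))"

text \<open>The largest of the lower bounds that the rows with negative lead put on the first
  variable once the others are \<open>y\<close>; starting at 0 accounts for the implicit
  bound.\<close>

definition least_value :: "row list \<Rightarrow> real list \<Rightarrow> real" where
  "least_value S y =
     foldl (\<lambda>m s. max m ((snd s - dot (tl (fst s)) y) / lead (fst s))) 0
       (filter (\<lambda>s. lead (fst s) < 0) S)"

text \<open>Only the length of the first argument matters: it is the number of variables.\<close>

primrec solve :: "'a list \<Rightarrow> row list \<Rightarrow> real list" where
  "solve [] S = []"
| "solve (v # vs) S =
     least_value S (solve vs (eliminate S)) # solve vs (eliminate S)"

text \<open>The default \<open>lead [] = 0\<close> makes this hold for empty \<open>a\<close> as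
  well.\<close>

lemma dot_Cons: "dot a (x # y) = lead a * x + dot (tl a) y"
  by (cases a) (simp_all add: dot_def lead_def)

lemma dot_combine:
  assumes "length a = length c"
  shows "dot (map (\<lambda>p. fst p / k - snd p / l) (zip a c)) y = dot a y / k - dot c y / l"
  using assms
proof (induction a c arbitrary: y rule: list_induct2)
  case Nil
  then show ?case by (simp add: dot_def)
next
  case (Cons u a w c)
  show ?case
  proof (cases y)
    case Nil
    then show ?thesis by (simp add: dot_def)
  next
    case (Cons z zs)
    then show ?thesis
      using Cons.IH[of zs] by (simp add: dot_Cons lead_def algebra_simps add_divide_distrib)
  qed
qed

lemma foldl_max_ge_start:
  fixes g :: "'a \<Rightarrow> real"
  shows "m \<le> foldl (\<lambda>m s. max m (g s)) m xs"
proof (induction xs arbitrary: m)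
  case (Cons x xs)
  show ?case
    using Cons.IH[of "max m (g x)"] by simp
qed simp

lemma foldl_max_ge:
  fixes g :: "'a \<Rightarrow> real"
  shows "s \<in> set xs \<Longrightarrow> g s \<le> foldl (\<lambda>m s. max m (g s)) m xs"
proof (induction xs arbitrary: m)
  case (Cons x xs)
  show ?case
    using Cons foldl_max_ge_start[of "max m (g x)"] by auto
qed simp

lemma foldl_max_le:
  fixes g :: "'a \<Rightarrow> real"
  shows "m \<le> u \<Longrightarrow> (\<And>s. s \<in> set xs \<Longrightarrow> g s \<le> u) \<Longrightarrow> foldl (\<lambda>m s. max m (g s)) m xs \<le> u"
  by (induction xs arbitrary: m) auto

lemma eliminate_cases:
  assumes "t \<in> set (eliminate S)"
  obtains (keep) r where "r \<in> set S" "0 \<le> lead (fst r)" "t = (tl (fst r), snd r)"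
    | (combine) r s where "r \<in> set S" "s \<in> set S" "0 < lead (fst r)" "lead (fst s) < 0"
        "t = combine r s"
  using assms by (auto simp: eliminate_def not_less)

lemma eliminate_length:
  assumes "\<forall>r\<in>set S. length (fst r) = Suc n" and "r \<in> set (eliminate S)"
  shows "length (fst r) = n"
  using assms(2) by (cases rule: eliminate_cases) (simp_all add: combine_def assms(1))

text \<open>A kept row only loses the nonnegative term \<open>lead (fst r) * x\<close>; a combined
  row holds because \<open>x\<close> lies between the two bounds it compares.\<close>

lemma eliminate_sound:
  assumes len: "\<forall>r\<in>set S. length (fst r) = Suc n" and "0 \<le> x"
    and sat: "\<forall>r\<in>set S. dot (fst r) (x # y) \<le> snd r" and t: "t \<in> set (eliminate S)"
  shows "dot (fst t) y \<le> snd t"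
  using t
proof (cases rule: eliminate_cases)
  case (keep r)
  then have "lead (fst r) * x + dot (tl (fst r)) y \<le> snd r"
    using sat dot_Cons by metis
  then show ?thesis
    using keep mult_nonneg_nonneg[OF keep(2) \<open>0 \<le> x\<close>] by (simp del: mult_nonneg_nonneg)
next
  case (combine r s)
  have "lead (fst r) * x + dot (tl (fst r)) y \<le> snd r" "lead (fst s) * x + dot (tl (fst s)) y \<le> snd s"
    using sat combine dot_Cons by metis+
  then have "x \<le> (snd r - dot (tl (fst r)) y) / lead (fst r)"
    and "(snd s - dot (tl (fst s)) y) / lead (fst s) \<le> x"
    using combine by (simp_all add: field_simps)
  then show ?thesis
    using combine len dot_combine[of "tl (fst r)" "tl (fst s)"]
    by (simp add: combine_def diff_divide_distrib)
qed

text \<open>The chosen value meets all lower bounds by construction. It is below each upper bound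
  because the combined rows put every lower bound below it and the kept row puts 0 below it.\<close>

lemma eliminate_complete:
  assumes len: "\<forall>r\<in>set S. length (fst r) = Suc n"
    and sat: "\<forall>t\<in>set (eliminate S). dot (fst t) y \<le> snd t" and r: "r \<in> set S"
  shows "dot (fst r) (least_value S y # y) \<le> snd r"
proof -
  define m where "m = least_value S y"
  define bound where "bound s = (snd s - dot (tl (fst s)) y) / lead (fst s)" for s :: row
  have m: "m = foldl (\<lambda>m s. max m (bound s)) 0 (filter (\<lambda>s. lead (fst s) < 0) S)"
    by (simp add: m_def least_value_def bound_def)
  have keep: "dot (tl (fst r)) y \<le> snd r" if "0 \<le> lead (fst r)"
    using sat r that by (force simp: eliminate_def)
  have "lead (fst r) * m + dot (tl (fst r)) y \<le> snd r"
  proof (cases "lead (fst r)" "0 :: real" rule: linorder_cases)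
    case less
    then have "bound r \<le> m"
      unfolding m using r by (intro foldl_max_ge) auto
    then show ?thesis
      using less by (simp add: bound_def field_simps)
  next
    case equal
    then show ?thesis
      using keep by simp
  next
    case greater
    have "bound s \<le> bound r" if "s \<in> set S" "lead (fst s) < 0" for s
    proof -
      have "dot (fst (combine r s)) y \<le> snd (combine r s)"
        using sat r that greater by (auto simp: eliminate_def)
      then show ?thesis
        using r that len dot_combine[of "tl (fst r)" "tl (fst s)"]
        by (simp add: combine_def bound_def diff_divide_distrib)
    qed
    then have "m \<le> bound r"
      unfolding m using keep greater by (intro foldl_max_le) (auto simp: bound_def)
    then show ?thesis
      using greater by (simp add: bound_def field_simps)
  qed
  then show ?thesis
    by (simp add: dot_Cons m_def)
qed

text \<open>The point \<open>x\<close> only witnesses solvability: by soundness its tail solves the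
  eliminated system, and by completeness the solution found there extends to
  \<open>S\<close>.\<close>

lemma solve_correct:
  assumes "\<forall>r\<in>set S. length (fst r) = length vs" and "length x = length vs"
    and "\<forall>c\<in>set x. 0 \<le> c" and "\<forall>r\<in>set S. dot (fst r) x \<le> snd r"
  shows "length (solve vs S) = length vs \<and> (\<forall>c\<in>set (solve vs S). 0 \<le> c) \<and>
    (\<forall>r\<in>set S. dot (fst r) (solve vs S) \<le> snd r)"
  using assms
proof (induction vs arbitrary: S x)
  case Nil
  then show ?case by simp
next
  case (Cons v vs)
  then obtain c y where x: "x = c # y"
    by (cases x) auto
  have len: "\<forall>r\<in>set S. length (fst r) = Suc (length vs)"
    using Cons.prems by simp
  have "length (solve vs (eliminate S)) = length vs \<and> (\<forall>c\<in>set (solve vs (eliminate S)). 0 \<le> c) \<and>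
      (\<forall>r\<in>set (eliminate S). dot (fst r) (solve vs (eliminate S)) \<le> snd r)"
  proof (rule Cons.IH[where x = y])
    show "\<forall>r\<in>set (eliminate S). dot (fst r) y \<le> snd r"
      using eliminate_sound[OF len, of c y] Cons.prems x by simp
  qed (use Cons.prems x eliminate_length[OF len] in auto)
  moreover have "0 \<le> least_value S (solve vs (eliminate S))"
    unfolding least_value_def by (rule foldl_max_ge_start)
  ultimately show ?case
    using eliminate_complete[OF len] by simp
qed

section \<open>Programs for the linear solver\<close>

lemma computable_dot: "computable (\<lambda>z. dot (fst z) (snd z))"
  unfolding dot_def by (intro computable_intros)

lemma computable_lead: "computable lead"
  unfolding lead_def by (intro computable_intros)

lemmas [computable_intros] =
  computable_lift2[OF computable_dot] computable_compose[OF _ computable_lead]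

lemma computable_combine: "computable (\<lambda>z. combine (fst z) (snd z))"
  unfolding combine_def by (intro computable_intros)

lemmas [computable_intros] = computable_lift2[OF computable_combine]

lemma computable_eliminate: "computable eliminate"
  unfolding eliminate_def by (intro computable_intros)

lemma computable_least_value: "computable (\<lambda>z. least_value (fst z) (snd z))"
  unfolding least_value_def by (intro computable_intros)

lemmas [computable_intros] =
  computable_compose[OF _ computable_eliminate] computable_lift2[OF computable_least_value]

text \<open>The recursion is unrolled: a first loop stacks the successive systems, a second one unwinds
  the stack.\<close>

lemma computable_solve: "computable (\<lambda>z. solve (fst z :: 'a::codable list) (snd z))"
proof -
  let ?push = "\<lambda>p (v :: 'a). (eliminate (fst p), fst p # snd p)"
  let ?pop = "\<lambda>y S. least_value S y # y"
  have "foldl ?pop [] (snd (foldl ?push (S, st) vs)) = foldl ?pop (solve vs S) st" for S st vs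
    by (induction vs arbitrary: S st) auto
  moreover have "computable (\<lambda>z. foldl ?pop [] (snd (foldl ?push (snd z, []) (fst z))))"
    by (intro computable_intros)
  ultimately show ?thesis
    by simp
qed

lemmas [computable_intros] = computable_lift2[OF computable_solve]


section \<open>Computing a fair payoff vector\<close>

definition adjacent :: "(nat \<times> nat) list \<Rightarrow> nat \<Rightarrow> nat list \<Rightarrow> bool" where
  "adjacent es v P = (case P of [] \<Rightarrow> True
     | u # _ \<Rightarrow> \<exists>e\<in>set es. (fst e = u \<and> snd e = v) \<or> (fst e = v \<and> snd e = u))"

text \<open>One round of growing paths at the front. Putting \<open>[]\<close> back keeps the
  shorter paths: from \<open>[[]]\<close>, \<open>n\<close> rounds yield all simple paths with at
  most \<open>n\<close> nodes.\<close>

definition prepend :: "nat list \<Rightarrow> (nat \<times> nat) list \<Rightarrow> nat list list \<Rightarrow> nat list list" where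
  "prepend vs es L = [] # concat (map (\<lambda>P.
     map (\<lambda>v. v # P) (filter (\<lambda>v. \<not> (\<exists>u\<in>set P. u = v) \<and> adjacent es v P) vs)) L)"

text \<open>The list \<open>vs\<close> also serves as round counter: a simple path has at most
  \<open>length vs\<close> nodes.\<close>

definition simple_paths :: "nat list \<Rightarrow> (nat \<times> nat) list \<Rightarrow> nat list list" where
  "simple_paths vs es = foldl (\<lambda>L _. prepend vs es L) [[]] vs"

definition first :: "nat list \<Rightarrow> nat" where
  "first P = (case P of [] \<Rightarrow> 0 | v # _ \<Rightarrow> v)"

definition final :: "nat list \<Rightarrow> nat" where
  "final P = foldl (\<lambda>_ v. v) 0 P"

type_synonym instance_lists = "(nat \<times> real) list \<times> (nat \<times> nat) list \<times> ((nat \<times> nat) \<times> real) list"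

definition commodity_paths :: "instance_lists \<Rightarrow> nat list list" where
  "commodity_paths I =
     filter (\<lambda>P. \<exists>e\<in>set (snd (snd I)). first P = fst (fst e) \<and> final P = snd (fst e))
       (simple_paths (map fst (fst I)) (fst (snd I)))"

definition ends_in :: "nat \<Rightarrow> nat list \<Rightarrow> bool" where
  "ends_in v P \<longleftrightarrow> first P = v \<or> final P = v"

text \<open>The linear program defining fairness, with one variable per path in \<open>Ps\<close>:
  capacities, demands, and the condition that each payoff is at least \<open>t\<close>, negated to
  fit the form \<le>.\<close>

definition fair_rows :: "instance_lists \<Rightarrow> real \<Rightarrow> nat list list \<Rightarrow> row list" where
  "fair_rows I t Ps =
     map (\<lambda>v. (map (\<lambda>P. if \<exists>u\<in>set P. u = fst v then 1 else 0) Ps, snd v)) (fst I) @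
     map (\<lambda>e. (map (\<lambda>P. if first P = fst (fst e) \<and> final P = snd (fst e) then 1 else 0) Ps, snd e))
       (snd (snd I)) @
     map (\<lambda>v. (map (\<lambda>P. - (if ends_in (fst v) P then 1 else 0)) Ps, - t)) (fst I)"

definition fair_payoff :: "instance_lists \<Rightarrow> real \<Rightarrow> real list" where
  "fair_payoff I t =
     map (\<lambda>v. dot (map (\<lambda>P. if ends_in (fst v) P then 1 else 0) (commodity_paths I))
         (solve (commodity_paths I) (fair_rows I t (commodity_paths I))))
       (fst I)"

section \<open>Programs for path enumeration and the fair payoff vector\<close>

lemma computable_adjacent:
  "computable (\<lambda>z. adjacent (fst z) (fst (snd z)) (snd (snd z)))"
  unfolding adjacent_def by (intro computable_intros)

lemmas [computable_intros] = computable_lift3[OF computable_adjacent]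

lemma computable_prepend: "computable (\<lambda>z. prepend (fst z) (fst (snd z)) (snd (snd z)))"
  unfolding prepend_def by (intro computable_intros)

lemmas [computable_intros] = computable_lift3[OF computable_prepend]

lemma computable_simple_paths: "computable (\<lambda>z. simple_paths (fst z) (snd z))"
  unfolding simple_paths_def by (intro computable_intros)

lemma computable_first: "computable first"
  unfolding first_def by (intro computable_intros)

lemma computable_final: "computable final"
  unfolding final_def by (intro computable_intros)

lemmas [computable_intros] = computable_lift2[OF computable_simple_paths]
  computable_compose[OF _ computable_first] computable_compose[OF _ computable_final]

lemma computable_commodity_paths: "computable commodity_paths"
  unfolding commodity_paths_def by (intro computable_intros)

lemma computable_ends_in: "computable (\<lambda>z. ends_in (fst z) (snd z))"
  unfolding ends_in_def by (intro computable_intros)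

lemmas [computable_intros] =
  computable_compose[OF _ computable_commodity_paths] computable_lift2[OF computable_ends_in]

lemma computable_fair_rows: "computable (\<lambda>z. fair_rows (fst z) (fst (snd z)) (snd (snd z)))"
  unfolding fair_rows_def by (intro computable_intros)

lemmas [computable_intros] = computable_lift3[OF computable_fair_rows]

lemma computable_fair_payoff: "computable (\<lambda>z. fair_payoff (fst z) (snd z))"
  unfolding fair_payoff_def by (intro computable_intros)

lemmas [computable_intros] = computable_lift2[OF computable_fair_payoff]

section \<open>Correctness of the path enumeration\<close>

definition joined :: "(nat \<times> nat) list \<Rightarrow> nat \<Rightarrow> nat \<Rightarrow> bool" where
  "joined es u v \<longleftrightarrow> (u, v) \<in> set es \<or> (v, u) \<in> set es"

lemma adjacent_Cons: "adjacent es v (u # P) \<longleftrightarrow> joined es v u"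
  by (force simp: adjacent_def joined_def)

lemma set_prepend:
  "P \<in> set (prepend vs es L) \<longleftrightarrow> P = [] \<or>
    (\<exists>v Q. P = v # Q \<and> Q \<in> set L \<and> v \<in> set vs \<and> v \<notin> set Q \<and> adjacent es v Q)"
  by (auto simp: prepend_def)

lemma distinct_prepend:
  assumes "distinct vs" and "distinct L"
  shows "distinct (prepend vs es L)"
proof -
  have "distinct (concat (map (\<lambda>P. map (\<lambda>v. v # P) (filter (h P) vs)) L))" for h
    using assms by (induction L) (auto simp: distinct_map inj_on_def)
  then show ?thesis
    by (auto simp: prepend_def)
qed

lemma simple_paths_correct:
  assumes "distinct vs"
  shows "distinct (simple_paths vs es)"
    and "set (simple_paths vs es) = {P. distinct P \<and> set P \<subseteq> set vs \<and> successively (joined es) P}"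
proof -
  define paths_upto where "paths_upto n =
    {P. distinct P \<and> set P \<subseteq> set vs \<and> successively (joined es) P \<and> length P \<le> n}" for n
  have step: "set (prepend vs es L) = paths_upto (Suc n)" if "set L = paths_upto n" for L n
  proof (rule set_eqI)
    fix P
    show "P \<in> set (prepend vs es L) \<longleftrightarrow> P \<in> paths_upto (Suc n)"
    proof (cases P)
      case Nil
      then show ?thesis
        by (simp add: set_prepend paths_upto_def)
    next
      \<comment> \<open>A one-node path is split off: it has no edge to check, in accordance with
        the value of \<open>adjacent\<close> on \<open>[]\<close>.\<close>
      case (Cons v Q)
      then show ?thesis
        using that
        by (cases Q) (auto simp: set_prepend paths_upto_def adjacent_Cons, simp add: adjacent_def)
    qed
  qed
  have "set (foldl (\<lambda>L _. prepend vs es L) L us) = paths_upto (n + length us)"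
    if "set L = paths_upto n" for L n and us :: "nat list"
    using that
  proof (induction us arbitrary: L n)
    case (Cons u us)
    show ?case
      using Cons.IH[OF step[OF Cons.prems]] by simp
  qed simp
  moreover have "set [[]] = paths_upto 0"
    by (auto simp: paths_upto_def)
  ultimately have "set (simple_paths vs es) = paths_upto (length vs)"
    unfolding simple_paths_def by fastforce
  \<comment> \<open>This makes the length bound in \<open>paths_upto (length vs)\<close>
    vacuous.\<close>
  moreover have "length P \<le> length vs" if "distinct P" "set P \<subseteq> set vs" for P
    using that assms card_mono[of "set vs" "set P"] by (simp add: distinct_card)
  ultimately show "set (simple_paths vs es) =
      {P. distinct P \<and> set P \<subseteq> set vs \<and> successively (joined es) P}"
    by (auto simp: paths_upto_def)
  have "distinct (foldl (\<lambda>L _. prepend vs es L) L us)" if "distinct L" for L and us :: "nat list"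
    using that distinct_prepend[OF assms] by (induction us arbitrary: L) auto
  then show "distinct (simple_paths vs es)"
    by (simp add: simple_paths_def)
qed

lemma first_eq_hd: "P \<noteq> [] \<Longrightarrow> first P = hd P"
  by (cases P) (auto simp: first_def)

lemma final_eq_last: "P \<noteq> [] \<Longrightarrow> final P = last P"
  by (cases P rule: rev_cases) (auto simp: final_def)

section \<open>Games as lists\<close>

text \<open>The nesting is chosen so that \<open>enc\<close> reproduces \<open>enc_game\<close>
  exactly; programs on these lists thus run on encoded games.\<close>

definition instance_lists :: "game \<Rightarrow> instance_lists" where
  "instance_lists G =
     (map (\<lambda>v. (v, cap G v)) (node_list G), edge_list G (edges G),
      map (\<lambda>e. (e, demand G {fst e, snd e})) (edge_list G (commodities G)))"

lemma enc_instance_lists: "enc (instance_lists G) = enc_game G"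
proof -
  have edge: "enc_edge e = Node (Atom (real (fst e))) (Atom (real (snd e)))" for e
    by (simp add: enc_edge_def case_prod_unfold)
  then have "enc = enc_edge"
    by auto
  then show ?thesis
    by (simp add: instance_lists_def enc_game_def comp_def case_prod_unfold edge)
qed

lemma set_node_list: "mcf_game G \<Longrightarrow> set (node_list G) = nodes G"
  by (simp add: node_list_def mcf_game_def)

lemma set_edge_list:
  assumes "mcf_game G"
  shows "(u, v) \<in> set (edge_list G X) \<longleftrightarrow> u \<in> nodes G \<and> v \<in> nodes G \<and> u \<le> v \<and> {u, v} \<in> X"
  using set_node_list[OF assms] by (auto simp: edge_list_def)

lemma joined_edges:
  assumes "mcf_game G"
  shows "joined (edge_list G (edges G)) u v \<longleftrightarrow> {u, v} \<in> edges G"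
proof -
  have "{u, v} \<in> edges G \<Longrightarrow> u \<in> nodes G \<and> v \<in> nodes G"
    using assms by (fastforce simp: mcf_game_def doubleton_eq_iff)
  then show ?thesis
    using assms linear[of u v] by (auto simp: joined_def set_edge_list insert_commute)
qed

text \<open>Commodities have distinct ends, so each is listed in the same orientation, smaller end
  first, that \<open>paths\<close> selects.\<close>

lemma commodity_edge_list:
  assumes "mcf_game G"
  shows "(u, v) \<in> set (edge_list G (commodities G)) \<longleftrightarrow> u < v \<and> {u, v} \<in> commodities G"
proof -
  have "{u, v} \<in> commodities G \<Longrightarrow> u \<in> nodes G \<and> v \<in> nodes G \<and> u \<noteq> v"
    using assms by (fastforce simp: mcf_game_def doubleton_eq_iff)
  then show ?thesis
    using assms by (auto simp: set_edge_list)
qed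

text \<open>The enumeration yields both orientations of a path, but only the one from the smaller to
  the larger end matches a listed commodity.\<close>

lemma commodity_paths_correct:
  assumes "mcf_game G"
  shows "distinct (commodity_paths (instance_lists G))"
    and "set (commodity_paths (instance_lists G)) = all_paths G"
proof -
  have dist: "distinct (node_list G)"
    by (simp add: node_list_def)
  have joined: "joined (edge_list G (edges G)) = (\<lambda>u v. {u, v} \<in> edges G)"
    using joined_edges[OF assms] by blast
  have mem: "(\<exists>e\<in>set X. a = fst e \<and> b = snd e) \<longleftrightarrow> (a, b) \<in> set X" for X a b
    by force
  have map: "map fst (fst (instance_lists G)) = node_list G"
    by (simp add: instance_lists_def comp_def)
  show "distinct (commodity_paths (instance_lists G))"
    using simple_paths_correct(1)[OF dist] by (simp add: commodity_paths_def map)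
  show "set (commodity_paths (instance_lists G)) = all_paths G"
  proof (rule set_eqI)
    fix P
    have "P \<in> set (commodity_paths (instance_lists G)) \<longleftrightarrow>
        P \<in> set (simple_paths (node_list G) (edge_list G (edges G))) \<and>
        (first P, final P) \<in> set (edge_list G (commodities G))"
      by (simp add: commodity_paths_def instance_lists_def comp_def flip: mem)
    also have "\<dots> \<longleftrightarrow>
        distinct P \<and> set P \<subseteq> nodes G \<and> successively (\<lambda>u v. {u, v} \<in> edges G) P \<and>
        first P < final P \<and> {first P, final P} \<in> commodities G"
      using commodity_edge_list[OF assms]
      by (simp add: simple_paths_correct(2)[OF dist] joined set_node_list[OF assms])
    also have "\<dots> \<longleftrightarrow> P \<in> all_paths G"
    proof (cases "P = []")
      \<comment> \<open>Both \<open>first\<close> and \<open>final\<close> give 0 on the empty path,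
        so the strict inequality between them excludes it.\<close>
      case True
      then show ?thesis
        by (simp add: all_paths_def paths_def simple_path_def first_def final_def)
    next
      case False
      then show ?thesis
        by (auto simp: all_paths_def paths_def simple_path_def first_eq_hd final_eq_last)
    qed
    finally show "P \<in> set (commodity_paths (instance_lists G)) \<longleftrightarrow> P \<in> all_paths G" .
  qed
qed

lemma all_paths_ends: "P \<in> all_paths G \<Longrightarrow> first P = hd P \<and> final P = last P"
  by (auto simp: all_paths_def paths_def simple_path_def first_eq_hd final_eq_last)

section \<open>Flows and payoffs as sums over all commodity paths\<close>

lemma commodity_flow_eq_sum:
  assumes "u < w" and "{u, w} \<in> commodities G"
  shows "commodity_flow G f {u, w} = sum f {P \<in> all_paths G. first P = u \<and> final P = w}"
proof -
  have "P \<in> paths G {u, w} \<longleftrightarrow> P \<in> all_paths G \<and> first P = u \<and> final P = w" for P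
  proof
    assume P: "P \<in> paths G {u, w}"
    then have "P \<in> all_paths G"
      using assms(2) by (auto simp: all_paths_def)
    moreover have "hd P = u \<and> last P = w"
      using P assms(1) by (auto simp: paths_def doubleton_eq_iff)
    ultimately show "P \<in> all_paths G \<and> first P = u \<and> final P = w"
      using all_paths_ends by simp
  next
    assume "P \<in> all_paths G \<and> first P = u \<and> final P = w"
    then show "P \<in> paths G {u, w}"
      using all_paths_ends[of P G] by (auto simp: all_paths_def paths_def)
  qed
  then have "paths G {u, w} = {P \<in> all_paths G. first P = u \<and> final P = w}"
    by blast
  then show ?thesis
    by (simp add: commodity_flow_def)
qed

text \<open>A path ending at \<open>v\<close> belongs to exactly one commodity at \<open>v\<close>,
  given by its other end, so the double sum runs over a disjoint union.\<close>

lemma payoff_eq_sum: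
  assumes "mcf_game G"
  shows "payoff G f v = sum f {P \<in> all_paths G. ends_in v P}"
proof -
  define W where "W = {w. {w, v} \<in> commodities G}"
  have "W \<subseteq> nodes G"
    using assms by (fastforce simp: W_def mcf_game_def doubleton_eq_iff)
  then have fin_W: "finite W"
    using assms finite_subset by (auto simp: mcf_game_def)
  have fin: "finite (all_paths G)"
    using commodity_paths_correct(2)[OF assms] by (metis finite_set)
  have "payoff G f v = (\<Sum>w\<in>W. \<Sum>P\<in>paths G {w, v}. f P)"
    by (simp add: payoff_def commodity_flow_def W_def)
  also have "\<dots> = sum f (\<Union>w\<in>W. paths G {w, v})"
  proof (rule sum.UNION_disjoint[symmetric, OF fin_W])
    show "\<forall>w\<in>W. finite (paths G {w, v})"
      using finite_subset[OF _ fin] by (auto simp: W_def all_paths_def)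
    show "\<forall>w\<in>W. \<forall>w'\<in>W. w \<noteq> w' \<longrightarrow> paths G {w, v} \<inter> paths G {w', v} = {}"
      by (auto simp: paths_def doubleton_eq_iff)
  qed
  also have "(\<Union>w\<in>W. paths G {w, v}) = {P \<in> all_paths G. ends_in v P}"
  proof (intro set_eqI iffI)
    fix P
    assume "P \<in> (\<Union>w\<in>W. paths G {w, v})"
    then have "P \<in> all_paths G" "v \<in> {hd P, last P}"
      by (auto simp: W_def all_paths_def paths_def)
    then show "P \<in> {P \<in> all_paths G. ends_in v P}"
      using all_paths_ends[of P G] by (auto simp: ends_in_def)
  next
    fix P
    assume "P \<in> {P \<in> all_paths G. ends_in v P}"
    then have P: "P \<in> all_paths G" "hd P = v \<or> last P = v"
      using all_paths_ends[of P G] by (auto simp: ends_in_def)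
    from P(1) have "P \<in> paths G {hd P, last P}" "{hd P, last P} \<in> commodities G"
      by (auto simp: all_paths_def paths_def)
    moreover obtain w where "{w, v} = {hd P, last P}"
      using P(2) by blast
    ultimately have "w \<in> W" "P \<in> paths G {w, v}"
      by (simp_all add: W_def)
    then show "P \<in> (\<Union>w\<in>W. paths G {w, v})"
      by blast
  qed
  finally show ?thesis .
qed

lemma dot_indicator:
  assumes "distinct Ps"
  shows "dot (map (\<lambda>P. if q P then 1 else 0) Ps) (map f Ps) = sum f {P \<in> set Ps. q P}"
proof -
  have "dot (map (\<lambda>P. if q P then 1 else 0) Ps) (map f Ps) = sum_list (map (\<lambda>P. if q P then f P else 0) Ps)"
    by (induction Ps) (auto simp: dot_def)
  also have "\<dots> = sum f {P \<in> set Ps. q P}"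
    using assms by (simp add: sum_list_distinct_conv_sum_set sum.inter_filter)
  finally show ?thesis .
qed

lemma dot_uminus: "dot (map (\<lambda>P. - c P) Ps) x = - dot (map c Ps) x"
proof (induction Ps arbitrary: x)
  case (Cons P Ps)
  then show ?case
    by (cases x) (simp_all add: dot_def)
qed (simp add: dot_def)

text \<open>Nonnegativity of \<open>f\<close> is a hypothesis because the solver treats it as
  implicit and no row expresses it.\<close>

lemma fair_rows_correct:
  assumes game: "mcf_game G" and nonneg: "\<forall>P\<in>all_paths G. 0 \<le> f P"
  defines "I \<equiv> instance_lists G" and "Ps \<equiv> commodity_paths (instance_lists G)"
  shows "(\<forall>r\<in>set (fair_rows I t Ps). dot (fst r) (map f Ps) \<le> snd r) \<longleftrightarrow>
    feasible_flow G f \<and> (\<forall>v\<in>nodes G. t \<le> payoff G f v)"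
proof -
  note Ps = commodity_paths_correct[OF game, folded Ps_def]
  \<comment> \<open>The rows index commodities by ordered pairs, the definition of feasibility by
    sets; this translates between them.\<close>
  have e: "e \<in> commodities G \<longleftrightarrow> (\<exists>u w. u < w \<and> {u, w} \<in> commodities G \<and> e = {u, w})" for e
  proof
    assume "e \<in> commodities G"
    then obtain u w where "e = {u, w}" "u \<noteq> w"
      using game unfolding mcf_game_def by blast
    with \<open>e \<in> commodities G\<close> show "\<exists>u w. u < w \<and> {u, w} \<in> commodities G \<and> e = {u, w}"
      by (metis insert_commute linorder_neqE_nat)
  qed auto
  let ?flow = "\<lambda>u w. sum f {P \<in> all_paths G. first P = u \<and> final P = w}"
  have "(\<forall>e\<in>commodities G. commodity_flow G f e \<le> demand G e) \<longleftrightarrow>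
      (\<forall>u w. u < w \<and> {u, w} \<in> commodities G \<longrightarrow> commodity_flow G f {u, w} \<le> demand G {u, w})"
    by (intro iffI ballI allI impI) (simp, metis e)
  also have "\<dots> \<longleftrightarrow>
      (\<forall>u w. u < w \<and> {u, w} \<in> commodities G \<longrightarrow> ?flow u w \<le> demand G {u, w})"
    by (simp add: commodity_flow_eq_sum)
  also have "\<dots> \<longleftrightarrow>
      (\<forall>u w. (u, w) \<in> set (edge_list G (commodities G)) \<longrightarrow> ?flow u w \<le> demand G {u, w})"
    by (simp add: commodity_edge_list[OF game])
  also have "\<dots> \<longleftrightarrow> (\<forall>e\<in>set (edge_list G (commodities G)).
      ?flow (fst e) (snd e) \<le> demand G {fst e, snd e})"
    by force
  finally have demands: "(\<forall>e\<in>commodities G. commodity_flow G f e \<le> demand G e) \<longleftrightarrow>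
      (\<forall>e\<in>set (edge_list G (commodities G)). ?flow (fst e) (snd e) \<le> demand G {fst e, snd e})" .
  show ?thesis
    using nonneg
    by (simp add: fair_rows_def I_def instance_lists_def ball_Un dot_indicator[OF Ps(1)] Ps(2)
        dot_uminus set_node_list[OF game] feasible_flow_def payoff_eq_sum[OF game] demands)
qed

text \<open>The flow \<open>g\<close> provided by fairness shows that the system is solvable; the
  solver then returns a solution \<open>x\<close>, whose entries define the flow
  \<open>f\<close>.\<close>

lemma fair_payoff_correct:
  assumes game: "mcf_game G" and fair: "fairness_at_least G t"
  obtains f where "f \<in> coalition_flows G (nodes G)" and "\<forall>v\<in>nodes G. t \<le> payoff G f v"
    and "fair_payoff (instance_lists G) t = map (payoff G f) (node_list G)"
proof -
  define Ps where "Ps = commodity_paths (instance_lists G)"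
  define S where "S = fair_rows (instance_lists G) t Ps"
  define x where "x = solve Ps S"
  note Ps = commodity_paths_correct[OF game, folded Ps_def]
  note rows = fair_rows_correct[OF game, where t = t, folded Ps_def, folded S_def]
  obtain g where g: "g \<in> coalition_flows G (nodes G)" "\<forall>v\<in>nodes G. t \<le> payoff G g v"
    using fair by (auto simp: fairness_at_least_def payoffs_def)
  have x: "length x = length Ps \<and> (\<forall>c\<in>set x. 0 \<le> c) \<and> (\<forall>r\<in>set S. dot (fst r) x \<le> snd r)"
    unfolding x_def
  proof (rule solve_correct[where x = "map g Ps"])
    show "\<forall>r\<in>set S. length (fst r) = length Ps"
      by (auto simp: S_def fair_rows_def)
    show "\<forall>c\<in>set (map g Ps). 0 \<le> c"
      using g(1) Ps(2) by (auto simp: coalition_flows_def feasible_flow_def)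
    show "\<forall>r\<in>set S. dot (fst r) (map g Ps) \<le> snd r"
      using g rows[of g] by (auto simp: coalition_flows_def feasible_flow_def)
  qed simp
  \<comment> \<open>Reads the solution back as a function on paths; its values outside
    \<open>Ps\<close> are irrelevant.\<close>
  define f where "f P = the (map_of (zip Ps x) P)" for P
  have f: "map f Ps = x"
    using x Ps(1) by (intro nth_equalityI) (auto simp: f_def map_of_zip_nth)
  have "\<forall>P\<in>all_paths G. 0 \<le> f P"
    using x Ps(2) by (metis f image_eqI list.set_map)
  then have feasible: "feasible_flow G f" "\<forall>v\<in>nodes G. t \<le> payoff G f v"
    using rows[of f] x f by auto
  show thesis
  proof (rule that)
    show "f \<in> coalition_flows G (nodes G)"
      using feasible(1)
      by (auto simp: coalition_flows_def all_paths_def paths_def simple_path_def)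
    show "fair_payoff (instance_lists G) t = map (payoff G f) (node_list G)"
      by (simp add: fair_payoff_def flip: Ps_def S_def x_def f)
        (simp add: instance_lists_def dot_indicator[OF Ps(1)] Ps(2) payoff_eq_sum[OF game])
  qed (fact feasible(2))
qed

section \<open>Linearity of payoffs and convexity of the set of feasible flows\<close>

lemma payoff_convex:
  "payoff G (\<lambda>P. a * f P + b * g P) v = a * payoff G f v + b * payoff G g v"
  by (simp add: payoff_def commodity_flow_def sum.distrib sum_distrib_left)

lemma payoff_nonneg:
  assumes "feasible_flow G f"
  shows "0 \<le> payoff G f v"
  using assms unfolding payoff_def commodity_flow_def
  by (intro sum_nonneg) (auto simp: feasible_flow_def all_paths_def)

lemma feasible_flow_convex:
  assumes "feasible_flow G f" and "feasible_flow G g" and "0 \<le> a" "0 \<le> b" "a + b = 1"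
  shows "feasible_flow G (\<lambda>P. a * f P + b * g P)"
  using assms convex_bound_le[of _ _ _ a b]
  by (simp add: feasible_flow_def commodity_flow_def sum.distrib flip: sum_distrib_left)


section \<open>Mixing a core vector with a fair vector\<close>

theorem theorem3:
  fixes \<G> :: "game set" and A :: prog
  assumes "\<forall>G\<in>\<G>. mcf_game G"
    and "core_producing A \<G>"
  shows "\<exists>B :: prog. \<forall>G\<in>\<G>. \<forall>\<tau> lam :: real.
    0 \<le> \<tau> \<longrightarrow> fairness_at_least G \<tau> \<longrightarrow> 0 < lam \<longrightarrow> lam < 1 \<longrightarrow>
    (\<exists>\<pi>\<in>approx_core G (1 / (1 - lam)).
       fairness G \<pi> \<ge> lam * \<tau> \<and>
       runs B (Node (enc_game G) (Node (Atom lam) (Atom \<tau>))) (enc_payoff G \<pi>))"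
proof -
  \<comment> \<open>\<open>z\<close> consists of the output of \<open>A\<close> followed by the
    input of \<open>B\<close>: the instance, \<open>lam\<close> and \<tau>.\<close>
  define mix where "mix z = map (\<lambda>p. (1 - fst (snd (snd z))) * fst p + fst (snd (snd z)) * snd p)
      (zip (fst z) (fair_payoff (fst (snd z)) (snd (snd (snd z)))))"
    for z :: "real list \<times> instance_lists \<times> real \<times> real"
  have "computable mix"
    unfolding mix_def by (intro computable_intros)
  then obtain M where M: "\<And>z. runs M (enc z) (enc (mix z))"
    unfolding computable_def by blast
  show ?thesis
  proof (intro exI ballI allI impI)
    fix G and \<tau> lam :: real
    assume "G \<in> \<G>" and "0 \<le> \<tau>" and fair: "fairness_at_least G \<tau>" and lam: "0 < lam" "lam < 1"
    then have game: "mcf_game G"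
      using assms(1) by blast
    obtain f where f: "f \<in> coalition_flows G (nodes G)" and core: "payoff G f \<in> core G"
      and A: "runs A (enc_game G) (enc_payoff G (payoff G f))"
      using assms(2) \<open>G \<in> \<G>\<close> by (fastforce simp: core_producing_def approx_core_def payoffs_def)
    obtain g where g: "g \<in> coalition_flows G (nodes G)" "\<forall>v\<in>nodes G. \<tau> \<le> payoff G g v"
      "fair_payoff (instance_lists G) \<tau> = map (payoff G g) (node_list G)"
      using fair_payoff_correct[OF game fair] .
    define h where "h P = (1 - lam) * f P + lam * g P" for P
    have pay: "payoff G h v = (1 - lam) * payoff G f v + lam * payoff G g v" for v
      unfolding h_def by (rule payoff_convex)
    have feasible: "feasible_flow G f" "feasible_flow G g"
      using f g(1) by (auto simp: coalition_flows_def)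
    have nonneg: "0 \<le> payoff G f v" "0 \<le> payoff G g v" for v
      using feasible payoff_nonneg by auto
    \<comment> \<open>The program runs \<open>A\<close> on the game, keeps a copy of the whole input
      beside the result, and mixes.\<close>
    show "\<exists>\<pi>\<in>approx_core G (1 / (1 - lam)). fairness G \<pi> \<ge> lam * \<tau> \<and>
        runs (PSeq (PNode (PSeq PLeft A) PId) M) (Node (enc_game G) (Node (Atom lam) (Atom \<tau>)))
          (enc_payoff G \<pi>)"
    proof (intro bexI conjI)
      have "lam * \<tau> \<le> payoff G h v" if "v \<in> nodes G" for v
        using g(2) that lam nonneg by (simp add: pay add_increasing)
      then show "fairness G (payoff G h) \<ge> lam * \<tau>"
        using game by (simp add: fairness_def mcf_game_def)
      have "feasible_flow G h"
        unfolding h_def using feasible lam by (intro feasible_flow_convex) auto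
      then have "payoff G h \<in> payoffs G (nodes G)"
        using f g(1) by (auto simp: payoffs_def coalition_flows_def h_def)
      moreover have False
        if S: "S \<noteq> {}" "S \<subset> nodes G" "p \<in> payoffs G S"
          and block: "\<forall>v\<in>S. 1 / (1 - lam) * payoff G h v < p v" for S p
      proof -
        \<comment> \<open>A coalition blocking the mixture by the factor
          \<open>1 / (1 - lam)\<close> also blocks the core vector, since the share of
          \<open>g\<close> in the payoff is nonnegative.\<close>
        have "payoff G f v < p v" if "v \<in> S" for v
        proof -
          have "(1 - lam) * payoff G f v \<le> payoff G h v"
            using lam nonneg by (simp add: pay)
          then have "payoff G f v \<le> 1 / (1 - lam) * payoff G h v"
            using lam by (simp add: field_simps)
          with block that show ?thesis
            by force
        qed
        then have "\<forall>v\<in>S. 1 * payoff G f v < p v"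
          by simp
        with core S show False
          unfolding approx_core_def mem_Collect_eq by blast
      qed
      ultimately show "payoff G h \<in> approx_core G (1 / (1 - lam))"
        unfolding approx_core_def mem_Collect_eq by blast
      \<comment> \<open>Payoffs are linear in the flow, so mixing the two listed vectors gives the
        payoff of \<open>h\<close>, although the flow \<open>f\<close> behind the output of
        \<open>A\<close> is never computed.\<close>
      have "enc (mix (map (payoff G f) (node_list G), instance_lists G, lam, \<tau>)) =
          enc_payoff G (payoff G h)"
        by (simp add: mix_def g(3) enc_payoff_def pay comp_def zip_map_map zip_same_conv_map)
      moreover have "enc (map (payoff G f) (node_list G), instance_lists G, lam, \<tau>) =
          Node (enc_payoff G (payoff G f)) (Node (enc_game G) (Node (Atom lam) (Atom \<tau>)))"
        by (simp add: enc_payoff_def comp_def flip: enc_instance_lists)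
      ultimately have "runs M (Node (enc_payoff G (payoff G f))
          (Node (enc_game G) (Node (Atom lam) (Atom \<tau>)))) (enc_payoff G (payoff G h))"
        using M by metis
      then show "runs (PSeq (PNode (PSeq PLeft A) PId) M)
          (Node (enc_game G) (Node (Atom lam) (Atom \<tau>))) (enc_payoff G (payoff G h))"
        by (rule runs.Seq[OF runs.Node[OF runs.Seq[OF runs.Left A] runs.Id]])
    qed
  qed
qed

end
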